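(* Let $R>0$ and let $S\subset\mathbb{R}^2$ be a nonempty compact set whose volume function satisfies $$V(r;S)=\mu(S)+L_0 r+\pi r^2,\qquad 0\le r<R,$$ for some constant $L_0$. Let $X$ be uniformly distributed on $B(S,R)\setminus S$ and let $D=\mathcal{D}(X,S)$. Then the random variable $D$ is absolutely continuous with density function $$f(r)=\frac{L_0+2\pi r}{L_0R+\pi R^2},\qquad 0\le r<R.$$ An alternative expression for this density is $$f(r)=\lambda f_1(r)+(1-\lambda)f_2(r),\qquad 0\le r<R,$$ where $\lambda=L_0(L_0+\pi R)^{-1}$, $f_1$ is the density function of a random variable $Z_1$ uniform in $(0,R)$, and $f_2$ is the density function of $RZ_2$, where $Z_2$ follows a Beta distribution with parameters $\alpha=2$ and $\beta=1$.
   Context: For $x\in\mathbb{R}^2$, $\mathcal{D}(x,S)=\inf_{y\in S}\|x-y\|$ is the Euclidean distance to $S$; $B(S,r)=\{x:\mathcal{D}(x,S)\le r\}$ is the closed $r$-parallel set; $\mu$ is Lebesgue measure on $\mathbb{R}^2$; $V(r;S)=\mu(B(S,r))$ is the volume function of $S$. Densities are understood up to Lebesgue-null sets. *)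

theory Defs
  imports "HOL-Probability.Probability"
begin

definition parallel_set :: "(real^2) set \<Rightarrow> real \<Rightarrow> (real^2) set" where
  "parallel_set S r = {x. infdist x S \<le> r}"

text \<open>For nonempty compact \<open>S\<close> the parallel sets are compact, so the real-valued measure agrees with the
  extended one.\<close>

definition volume_function :: "real \<Rightarrow> (real^2) set \<Rightarrow> real" where
  "volume_function r S = measure lborel (parallel_set S r)"

text \<open>On a probability space, a uniform variable on a Borel set \<open>A\<close> can only
  exist when \<open>0 < emeasure lborel A < \<infinity>\<close>:
  otherwise \<^const>\<open>uniform_measure\<close> does not yield a probability measure.\<close>

definition uniformly_distributed_on ::
  "'a measure \<Rightarrow> ('a \<Rightarrow> 'b::euclidean_space) \<Rightarrow> 'b set \<Rightarrow> bool" where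
  "uniformly_distributed_on M X A \<longleftrightarrow>
     X \<in> M \<rightarrow>\<^sub>M lborel \<and> distr M lborel X = uniform_measure lborel A"

text \<open>Since \<^const>\<open>ennreal\<close> maps negative reals to \<open>0\<close>, \<^const>\<open>distributed\<close> alone does not force a
  real-valued density to be nonnegative. Nonnegativity is required almost everywhere only, as
  densities are determined up to null sets.\<close>

definition has_density :: "'a measure \<Rightarrow> ('a \<Rightarrow> real) \<Rightarrow> (real \<Rightarrow> real) \<Rightarrow> bool" where
  "has_density M Y f \<longleftrightarrow>
     f \<in> borel_measurable lborel \<and> (AE x in lborel. 0 \<le> f x) \<and>
     distributed M lborel Y (\<lambda>x. ennreal (f x))"

definition beta_density :: "real \<Rightarrow> real \<Rightarrow> real \<Rightarrow> real" where
  "beta_density \<alpha> \<beta> x =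
     (if 0 < x \<and> x < 1 then x powr (\<alpha> - 1) * (1 - x) powr (\<beta> - 1) / Beta \<alpha> \<beta> else 0)"

end

theory Submission
  imports Defs
begin

text \<open>
  A point at distance \<open>r\<close> from \<open>S\<close> with nearest point \<open>y\<close> is the endpoint of a segment from \<open>y\<close> that
  passes through a point at distance \<open>s\<close> for each \<open>s < r\<close>. Moving outwards along these segments
  stretches distances by a factor of at most \<open>r / s\<close>, so null level sets of the distance function
  propagate outwards. The volume polynomial makes the level sets below \<open>R\<close> null, hence also the
  level set at \<open>R\<close>, where the hypothesis says nothing. The polynomial therefore extends to \<open>r = R\<close>,
  and its increments are the distribution function of \<open>D\<close>.
\<close>

section \<open>Null level sets of the distance function\<close>

text \<open>Squaring and adding the two nearest-point inequalities gives
  \<open>(p - q) \<bullet> (y - z) \<ge> 0\<close>. The difference of the two contracted points is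
  \<open>t *\<^sub>R (p - q) + (1 - t) *\<^sub>R (y - z)\<close>, so the cross term of its squared
  norm is nonnegative and the \<open>p - q\<close> part alone is a lower bound.\<close>

lemma norm_diff_le_of_nearest_points:
  fixes p q y z :: "'a::real_inner"
  assumes "norm (p - y) \<le> norm (p - z)" "norm (q - z) \<le> norm (q - y)" "0 \<le> t" "t \<le> 1"
  shows "t * norm (p - q) \<le> norm ((y + t *\<^sub>R (p - y)) - (z + t *\<^sub>R (q - z)))"
proof -
  let ?u = "p - q" and ?v = "y - z"
  have "(norm (p - y))\<^sup>2 \<le> (norm (p - z))\<^sup>2" "(norm (q - z))\<^sup>2 \<le> (norm (q - y))\<^sup>2"
    using assms by (auto intro: power_mono)
  then have uv: "0 \<le> ?u \<bullet> ?v"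
    unfolding power2_norm_eq_inner by (simp add: algebra_simps inner_commute)
  have "(t * norm ?u)\<^sup>2 \<le> t\<^sup>2 * (norm ?u)\<^sup>2 + 2 * (t * (1 - t)) * (?u \<bullet> ?v) + (1 - t)\<^sup>2 * (norm ?v)\<^sup>2"
    using uv assms by (simp add: power_mult_distrib)
  also have "\<dots> = (norm (t *\<^sub>R ?u + (1 - t) *\<^sub>R ?v))\<^sup>2"
    unfolding power2_norm_eq_inner
    by (simp add: inner_add_left inner_add_right inner_commute power2_eq_square algebra_simps)
  also have "t *\<^sub>R ?u + (1 - t) *\<^sub>R ?v = (y + t *\<^sub>R (p - y)) - (z + t *\<^sub>R (q - z))"
    by (simp add: algebra_simps)
  finally show ?thesis
    by (rule power2_le_imp_le) simp
qed

text \<open>Pulling each point of level \<open>r\<close> towards a nearest point of \<open>S\<close>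
  by the factor \<open>s / r\<close> lands in level \<open>s\<close>. This map is injective with an
  inverse that is Lipschitz with constant \<open>r / s\<close>, and Lipschitz maps of a Euclidean
  space into itself preserve null sets.\<close>

lemma negligible_infdist_level_mono:
  fixes S :: "'a::euclidean_space set"
  assumes S: "closed S" "S \<noteq> {}" and sr: "0 < s" "s \<le> r"
    and null: "negligible {x. infdist x S = s}"
  shows "negligible {x. infdist x S = r}"
proof -
  define E where "E = {x. infdist x S = r}"
  define t where "t = s / r"
  have t: "0 < t" "t \<le> 1" "t * r = s"
    using sr by (auto simp: t_def)
  have "\<exists>y\<in>S. infdist x S = dist x y" for x
    using infdist_attains_inf[OF S] by metis
  \<comment> \<open>Nearest points may fail to be unique, so \<open>n\<close> is an arbitrary choice
    and \<open>g\<close> may be discontinuous. The argument rests on the lower bound for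
    \<open>g\<close>, that is, on the regularity of its inverse.\<close>
  then obtain n where n: "\<And>x. n x \<in> S" "\<And>x. infdist x S = dist x (n x)"
    by metis
  define g where "g x = n x + t *\<^sub>R (x - n x)" for x
  have lower: "t * norm (p - q) \<le> norm (g p - g q)" for p q
    unfolding g_def
    by (rule norm_diff_le_of_nearest_points)
       (use n t infdist_le[of _ S] in \<open>auto simp: dist_norm[symmetric]\<close>)
  have "inj g"
  proof (rule injI)
    fix p q assume "g p = g q"
    then have "t * norm (p - q) \<le> 0"
      using lower[of p q] by simp
    then show "p = q"
      using t by (simp add: mult_le_0_iff)
  qed
  have "g ` E \<subseteq> {x. infdist x S = s}"
  proof safe
    fix p assume "p \<in> E"
    then have r: "dist p (n p) = r" "infdist p S = r"
      using n by (auto simp: E_def)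
    have "dist (g p) (n p) = s" "dist p (g p) = r - s"
    proof -
      show "dist (g p) (n p) = s"
        using r t by (simp add: g_def dist_norm)
      have "p - g p = (1 - t) *\<^sub>R (p - n p)"
        by (simp add: g_def algebra_simps)
      then have "dist p (g p) = (1 - t) * dist p (n p)"
        using t by (simp add: dist_norm)
      then show "dist p (g p) = r - s"
        using r t by (simp add: left_diff_distrib)
    qed
    \<comment> \<open>The point \<open>n p\<close> of \<open>S\<close> bounds the distance above by
      \<open>s\<close>; the triangle inequality from \<open>p\<close> bounds it below by
      \<open>r - (r - s)\<close>.\<close>
    then show "infdist (g p) S = s"
      using infdist_le[OF n(1), of "g p" p] infdist_triangle[of p S "g p"] r by simp
  qed
  then have "negligible (g ` E)"
    using null negligible_subset by blast
  then have "negligible (inv g ` g ` E)"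
  proof (rule negligible_locally_Lipschitz_image[OF order_refl])
    fix x assume "x \<in> g ` E"
    have "norm (inv g y - inv g x) \<le> (1 / t) * norm (y - x)" if "y \<in> g ` E" for y
      using that \<open>x \<in> g ` E\<close> lower t \<open>inj g\<close> by (auto simp: field_simps)
    then show "\<exists>T B. open T \<and> x \<in> T \<and> (\<forall>y\<in>g ` E \<inter> T. norm (inv g y - inv g x) \<le> B * norm (y - x))"
      by (intro exI[of _ UNIV] exI[of _ "1 / t"]) auto
  qed
  then show ?thesis
    using \<open>inj g\<close> by (simp add: E_def image_comp)
qed

section \<open>Parallel sets and their volume up to the endpoint\<close>

lemma borel_measurable_infdist [measurable]: "(\<lambda>x. infdist x S) \<in> borel_measurable borel"
  by (intro borel_measurable_continuous_onI continuous_intros)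

lemma parallel_set_measurable [measurable]: "parallel_set S r \<in> sets borel"
  unfolding parallel_set_def by measurable

lemma parallel_set_mono: "r \<le> s \<Longrightarrow> parallel_set S r \<subseteq> parallel_set S s"
  by (auto simp: parallel_set_def)

lemma compact_parallel_set:
  assumes "compact S" "S \<noteq> {}"
  shows "compact (parallel_set S r)"
proof -
  \<comment> \<open>\<open>compact_infdist_le\<close> asks for a positive radius; other radii are
    reached as closed subsets of this compact set.\<close>
  have "compact (parallel_set S (max r 1))"
    using compact_infdist_le[OF assms(2,1), of "max r 1"] by (simp add: parallel_set_def)
  moreover have "closed (parallel_set S r)"
    unfolding parallel_set_def by (intro closed_Collect_le continuous_intros)
  ultimately show ?thesis
    using compact_Int_closed inf.absorb2[OF parallel_set_mono[of r "max r 1" S]] by fastforce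
qed

lemma emeasure_parallel_set:
  assumes "compact S" "S \<noteq> {}"
  shows "emeasure lborel (parallel_set S r) = ennreal (volume_function r S)"
  unfolding volume_function_def
  using emeasure_compact_finite[OF compact_parallel_set[OF assms]]
  by (intro emeasure_eq_ennreal_measure) (simp add: less_top)

lemma fmeasurable_parallel_set:
  assumes "compact S" "S \<noteq> {}"
  shows "parallel_set S r \<in> fmeasurable lborel"
  by (rule fmeasurableI) (simp_all add: emeasure_parallel_set[OF assms])

text \<open>Exhaustion from inside determines only the measure of the open set
  \<open>infdist x S < R\<close>. What remains is the level set at \<open>R\<close>, which is null
  because an inner level set is.\<close>

lemma volume_function_extends_to_endpoint:
  fixes p :: "real \<Rightarrow> real"
  assumes S: "compact S" "S \<noteq> {}" and R: "0 < R" and p: "isCont p (R / 2)" "isCont p R"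
    and V: "\<And>r. 0 \<le> r \<Longrightarrow> r < R \<Longrightarrow> volume_function r S = p r"
  shows "volume_function R S = p R"
proof -
  have open_measure: "measure lborel {x. infdist x S < r} = p r"
    if r: "0 < r" "r \<le> R" and cont: "isCont p r" for r
  proof -
    \<comment> \<open>The radii increase to \<open>r\<close> but stay strictly below it, so
      \<open>V\<close> applies to each of them even when \<open>r = R\<close>.\<close>
    define a where "a n = r - r / (real n + 2)" for n
    have a: "0 \<le> a n" "a n < r" for n
      using r by (auto simp: a_def field_simps)
    have lim: "a \<longlonglongrightarrow> r"
      unfolding a_def by real_asymp
    have "incseq a"
      unfolding a_def using r by (auto intro!: incseq_SucI simp: field_simps)
    have Un: "(\<Union>n. parallel_set S (a n)) = {x. infdist x S < r}"
    proof safe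
      fix x n assume "x \<in> parallel_set S (a n)"
      then show "infdist x S < r"
        using a(2)[of n] by (simp add: parallel_set_def)
    next
      fix x assume "infdist x S < r"
      then have "\<forall>\<^sub>F n in sequentially. infdist x S < a n"
        using lim by (auto simp: order_tendsto_iff)
      then show "x \<in> (\<Union>n. parallel_set S (a n))"
        by (auto simp: parallel_set_def eventually_sequentially intro: less_imp_le)
    qed
    have "{x. infdist x S < r} \<subseteq> parallel_set S r"
      by (auto simp: parallel_set_def)
    then have "emeasure lborel {x. infdist x S < r} \<noteq> \<infinity>"
      using emeasure_mono[of _ "parallel_set S r" lborel] emeasure_parallel_set[OF S, of r]
      by (metis ennreal_less_top infinity_ennreal_def leD parallel_set_measurable sets_lborel)
    then have "(\<lambda>n. measure lborel (parallel_set S (a n))) \<longlonglongrightarrow> measure lborel {x. infdist x S < r}"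
      unfolding Un[symmetric]
      using \<open>incseq a\<close> by (intro Lim_measure_incseq) (auto simp: incseq_def intro!: parallel_set_mono)
    moreover have "measure lborel (parallel_set S (a n)) = p (a n)" for n
      using V[of "a n"] a[of n] r by (simp add: volume_function_def)
    moreover have "(\<lambda>n. p (a n)) \<longlonglongrightarrow> p r"
      using cont lim by (rule isCont_tendsto_compose)
    ultimately show ?thesis
      by (simp add: LIMSEQ_unique)
  qed
  have fin: "A \<in> fmeasurable lborel" if "A \<subseteq> parallel_set S r" "A \<in> sets borel" for A r
    using that by (intro fmeasurableI2[OF fmeasurable_parallel_set[OF S]]) simp_all
  have level: "{x. infdist x S = r} \<in> fmeasurable lborel" for r
    by (rule fin[of _ r]) (auto simp: parallel_set_def)
  have split: "volume_function r S = measure lborel {x. infdist x S < r} + measure lborel {x. infdist x S = r}" for r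
  proof -
    have "parallel_set S r = {x. infdist x S < r} \<union> {x. infdist x S = r}"
      by (auto simp: parallel_set_def)
    moreover have "{x. infdist x S < r} \<in> fmeasurable lborel"
      by (rule fin[of _ r]) (auto simp: parallel_set_def)
    moreover have "{x. infdist x S < r} \<inter> {x. infdist x S = r} = {}"
      by auto
    ultimately show ?thesis
      using level[of r] measure_Un3[of "{x. infdist x S < r}" lborel "{x. infdist x S = r}"]
      unfolding volume_function_def by simp
  qed
  have null_iff: "measure lborel {x. infdist x S = r} = 0 \<longleftrightarrow> negligible {x. infdist x S = r}" for r
  proof -
    have "{x. infdist x S = r} \<in> sets borel"
      by measurable
    then show ?thesis
      using emeasure_eq_measure2[OF level[of r]]
      by (auto simp: negligible_iff_null_sets null_sets_completion_iff null_sets_def)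
  qed
  \<comment> \<open>At a radius strictly inside the range, \<open>V\<close> gives the closed
    parallel set and \<open>open_measure\<close> the open one. Both equal \<open>p (R / 2)\<close>,
    so the level set between them has measure zero.\<close>
  have "measure lborel {x. infdist x S = R / 2} = 0"
    using split[of "R / 2"] open_measure[of "R / 2"] V[of "R / 2"] R p by simp
  then have "negligible {x. infdist x S = R / 2}"
    by (simp only: null_iff)
  with compact_imp_closed[OF S(1)] S(2) have "negligible {x. infdist x S = R}"
    using negligible_infdist_level_mono[of S "R / 2" R] R by simp
  then have "measure lborel {x. infdist x S = R} = 0"
    by (simp add: null_iff)
  then show ?thesis
    using split[of R] open_measure[of R] R p by simp
qed

section \<open>The law of the distance\<close>

text \<open>The shell \<open>parallel_set S r - S\<close> has measure \<open>F r\<close>, so the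
  distribution function of the distance is \<open>F r / F R\<close> on \<open>[0, R]\<close>. The
  fundamental theorem of calculus identifies it with the integral of \<open>f / F R\<close>.\<close>

lemma distributed_infdist:
  fixes F f :: "real \<Rightarrow> real"
  assumes S: "compact S" "S \<noteq> {}" and R: "0 \<le> R" and M: "prob_space M"
    and X: "uniformly_distributed_on M X (parallel_set S R - S)"
    and V: "\<And>r. 0 \<le> r \<Longrightarrow> r \<le> R \<Longrightarrow> volume_function r S = measure lborel S + F r"
    and F: "\<And>r. (F has_real_derivative f r) (at r)" "F 0 = 0"
    and f: "f \<in> borel_measurable borel" "\<And>r. 0 \<le> r \<Longrightarrow> 0 \<le> f r"
  shows "distributed M lborel (\<lambda>\<omega>. infdist (X \<omega>) S) (\<lambda>r. ennreal (if 0 \<le> r \<and> r < R then f r / F R else 0))"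
proof -
  interpret prob_space M by fact
  have Xm [measurable]: "X \<in> M \<rightarrow>\<^sub>M borel" and
    law: "distr M lborel X = uniform_measure lborel (parallel_set S R - S)"
    using X by (auto simp: uniformly_distributed_on_def)
  have [measurable]: "S \<in> sets borel" and [measurable]: "f \<in> borel_measurable borel"
    using S f by (auto intro: borel_compact)
  have F_nonneg: "0 \<le> F r" if "0 \<le> r" for r
    using DERIV_nonneg_imp_nondecreasing[OF that, of F] F f by force
  have S_sub: "S \<subseteq> parallel_set S r" if "0 \<le> r" for r
    using that by (auto simp: parallel_set_def)
  have S_fin: "emeasure lborel S = ennreal (measure lborel S)"
    using emeasure_compact_finite[OF S(1)] by (intro emeasure_eq_ennreal_measure) (simp add: less_top)
  have shell: "emeasure lborel (parallel_set S r - S) = ennreal (F r)" if "0 \<le> r" "r \<le> R" for r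
    using that S_sub[of r] S_fin emeasure_parallel_set[OF S, of r] V[of r]
    by (subst emeasure_Diff) (auto simp: ennreal_minus)
  \<comment> \<open>Positivity of \<open>F R\<close> comes from the existence of \<open>X\<close>:
    if \<open>F R\<close> were 0, the total mass of the uniform measure would be
    \<open>0 / 0\<close>, which is 0 in \<open>ennreal\<close>.\<close>
  have "emeasure (distr M lborel X) UNIV = 1"
    using prob_space.emeasure_space_1[OF prob_space_distr[of X lborel]] by simp
  then have "ennreal (F R) / ennreal (F R) = 1"
    unfolding law using R by (simp add: shell)
  then have pos: "0 < F R"
    using F_nonneg[OF R] by (cases "F R = 0") auto
  \<comment> \<open>Clamping to \<open>[0, R]\<close> lets one formula cover negative
    \<open>a\<close> and \<open>a\<close> beyond \<open>R\<close>.\<close>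
  let ?m = "\<lambda>a. max 0 (min a R)"
  show ?thesis
  proof (rule distributedI_borel_atMost[where g = "\<lambda>a. F (?m a) / F R"])
    show "AE r in lborel. 0 \<le> (if 0 \<le> r \<and> r < R then f r / F R else 0)"
      using pos f by auto
  next
    fix a
    \<comment> \<open>The integrands below can differ only at 0, where the interval degenerates to
      \<open>{0}\<close> for negative \<open>a\<close>, and at \<open>R\<close>, an endpoint that
      the density excludes.\<close>
    have "AE r in lborel. r \<noteq> 0 \<and> r \<noteq> R"
      using AE_lborel_singleton[of 0] AE_lborel_singleton[of R] by eventually_elim simp
    then have "AE r in lborel. ennreal ((if 0 \<le> r \<and> r < R then f r / F R else 0) * indicator {..a} r)
        = ennreal (f r / F R) * indicator {0..?m a} r"
      by eventually_elim (auto split: split_indicator)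
    then have "(\<integral>\<^sup>+r. ennreal ((if 0 \<le> r \<and> r < R then f r / F R else 0) * indicator {..a} r) \<partial>lborel)
        = (\<integral>\<^sup>+r. ennreal (f r / F R) * indicator {0..?m a} r \<partial>lborel)"
      by (rule nn_integral_cong_AE)
    also have "\<dots> = ennreal (F (?m a) / F R - F 0 / F R)"
      using pos f F by (intro nn_integral_FTC_Icc) (auto intro!: derivative_eq_intros DERIV_subset[OF F(1)])
    finally show "(\<integral>\<^sup>+r. ennreal ((if 0 \<le> r \<and> r < R then f r / F R else 0) * indicator {..a} r) \<partial>lborel)
        = ennreal (F (?m a) / F R)"
      using F by simp
    have "emeasure M {\<omega> \<in> space M. infdist (X \<omega>) S \<le> a} = emeasure (distr M lborel X) (parallel_set S a)"
      by (subst emeasure_distr) (auto simp: parallel_set_def intro!: arg_cong[where f="emeasure M"])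
    also have "\<dots> = emeasure lborel ((parallel_set S R - S) \<inter> parallel_set S a) / ennreal (F R)"
      unfolding law using R by (simp add: shell)
    also have "(parallel_set S R - S) \<inter> parallel_set S a = parallel_set S (?m a) - S"
    proof (rule set_eqI)
      fix x
      \<comment> \<open>Closedness makes \<open>S\<close> the zero level set, so both sides are
        empty for negative \<open>a\<close>.\<close>
      have "x \<in> S \<longleftrightarrow> infdist x S = 0"
        using S by (intro in_closed_iff_infdist_zero compact_imp_closed)
      then show "x \<in> (parallel_set S R - S) \<inter> parallel_set S a \<longleftrightarrow> x \<in> parallel_set S (?m a) - S"
        using infdist_nonneg[of x S] by (auto simp: parallel_set_def)
    qed
    finally show "emeasure M {\<omega> \<in> space M. infdist (X \<omega>) S \<le> a} = ennreal (F (?m a) / F R)"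
      using R pos F_nonneg by (simp add: shell divide_ennreal)
  qed measurable
qed

section \<open>The two mixture components\<close>

lemma uniform_density_unique:
  assumes "prob_space M" "uniformly_distributed_on M Z {0<..<R}" "has_density M Z f" "0 < R"
  shows "AE r in lborel. 0 < r \<and> r < R \<longrightarrow> f r = 1 / R"
proof -
  interpret prob_space M by fact
  have "distributed M lborel Z (\<lambda>r. indicator {0<..<R} r / ennreal R)"
    using assms by (simp add: distributed_def uniformly_distributed_on_def uniform_measure_def)
  then have "AE r in lborel. ennreal (f r) = indicator {0<..<R} r / ennreal R"
    using assms by (intro distributed_unique) (auto simp: has_density_def)
  moreover have "AE r in lborel. 0 \<le> f r"
    using assms by (simp add: has_density_def)
  ultimately show ?thesis
  proof eventually_elim
    case (elim r)
    have "indicator {0<..<R} r / ennreal R = ennreal (1 / R)" if "0 < r" "r < R"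
      using that \<open>0 < R\<close> divide_ennreal[of 1 R] by simp
    moreover have "0 \<le> 1 / R"
      using \<open>0 < R\<close> by simp
    ultimately show ?case
      using elim by (metis ennreal_inj)
  qed
qed

text \<open>\<open>Beta 2 1\<close> is Gamma(2) Gamma(1) / Gamma(3) = 1/2, and
  \<open>(1 - x) powr 0\<close> is 1 inside the interval.\<close>

lemma beta_density_2_1: "beta_density 2 1 x = (if 0 < x \<and> x < 1 then 2 * x else 0)"
  by (simp add: beta_density_def Beta_def Gamma_numeral)

lemma scaled_beta_density_unique:
  assumes "prob_space M" "has_density M Z (beta_density 2 1)" "has_density M (\<lambda>\<omega>. R * Z \<omega>) f" "0 < R"
  shows "AE r in lborel. 0 < r \<and> r < R \<longrightarrow> f r = 2 * r / R\<^sup>2"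
proof -
  interpret prob_space M by fact
  \<comment> \<open>The zeros put the scaling into the affine form of
    \<open>distributed_affine\<close>; the transformed density is \<open>2 * (r / R) / R\<close> on
    the open interval.\<close>
  have "distributed M lborel (\<lambda>\<omega>. 0 + R * Z \<omega>) (\<lambda>r. ennreal (beta_density 2 1 ((r - 0) / R)) / ennreal \<bar>R\<bar>)"
    using assms by (intro distributed_affine) (auto simp: has_density_def)
  then have "AE r in lborel. ennreal (f r) = ennreal (beta_density 2 1 ((r - 0) / R)) / ennreal \<bar>R\<bar>"
    using assms by (intro distributed_unique) (auto simp: has_density_def)
  moreover have "AE r in lborel. 0 \<le> f r"
    using assms by (simp add: has_density_def)
  ultimately show ?thesis
  proof eventually_elim
    case (elim r)
    with \<open>0 < R\<close> show ?case
      by (auto simp: beta_density_2_1 divide_ennreal power2_eq_square)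
  qed
qed

theorem proposition2:
  fixes R L\<^sub>0 :: real
    and S :: "(real^2) set"
    and M :: "'a measure"
    and X :: "'a \<Rightarrow> real^2"
  assumes "R > 0"
    and "compact S" and "S \<noteq> {}"
    and "\<And>r. 0 \<le> r \<Longrightarrow> r < R \<Longrightarrow>
           volume_function r S = measure lborel S + L\<^sub>0 * r + pi * r\<^sup>2"
    and "prob_space M"
    and "uniformly_distributed_on M X (parallel_set S R - S)"
  shows "let D = (\<lambda>\<omega>. infdist (X \<omega>) S);
             f = (\<lambda>r. (L\<^sub>0 + 2 * pi * r) / (L\<^sub>0 * R + pi * R\<^sup>2));
             w = L\<^sub>0 * inverse (L\<^sub>0 + pi * R)
         in has_density M D (\<lambda>r. if 0 \<le> r \<and> r < R then f r else 0) \<and>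
            (\<forall>(M\<^sub>1 :: 'b measure) Z\<^sub>1 f\<^sub>1 (M\<^sub>2 :: 'c measure) Z\<^sub>2 f\<^sub>2.
               prob_space M\<^sub>1 \<longrightarrow> uniformly_distributed_on M\<^sub>1 Z\<^sub>1 {0<..<R} \<longrightarrow>
               has_density M\<^sub>1 Z\<^sub>1 f\<^sub>1 \<longrightarrow>
               prob_space M\<^sub>2 \<longrightarrow> has_density M\<^sub>2 Z\<^sub>2 (beta_density 2 1) \<longrightarrow>
               has_density M\<^sub>2 (\<lambda>\<omega>. R * Z\<^sub>2 \<omega>) f\<^sub>2 \<longrightarrow>
               (AE r in lborel. 0 \<le> r \<and> r < R \<longrightarrow>
                  f r = w * f\<^sub>1 r + (1 - w) * f\<^sub>2 r))"
proof -
  note R = assms(1) and S = assms(2,3) and V = assms(4)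
  define F where "F r = L\<^sub>0 * r + pi * r\<^sup>2" for r :: real
  define f where "f r = L\<^sub>0 + 2 * pi * r" for r :: real
  have V_le: "volume_function r S = measure lborel S + F r" if "0 \<le> r" "r \<le> R" for r
  proof (cases "r < R")
    case False
    have "volume_function R S = measure lborel S + F R"
      by (rule volume_function_extends_to_endpoint[OF S R]) (auto simp: F_def V add.assoc)
    with False that show ?thesis by simp
  qed (use that V in \<open>simp add: F_def add.assoc\<close>)
  \<comment> \<open>The sign of \<open>L\<^sub>0\<close> is derived here: \<open>S\<close> lies in
    each parallel set, so \<open>r * (L\<^sub>0 + pi * r)\<close> is nonnegative. Dividing by
    \<open>r\<close> and letting \<open>r\<close> tend to 0 from the right gives
    \<open>L\<^sub>0 \<ge> 0\<close>, hence a nonnegative density and positive denominators.\<close>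
  have "0 \<le> L\<^sub>0 + pi * r" if "0 < r" "r < R" for r
  proof -
    have "measure lborel S \<le> volume_function r S"
      unfolding volume_function_def using that S
      by (intro measure_mono_fmeasurable fmeasurable_parallel_set)
        (auto simp: parallel_set_def borel_compact)
    then have "0 \<le> r * (L\<^sub>0 + pi * r)"
      using V[of r] that by (simp add: power2_eq_square algebra_simps)
    then show ?thesis
      using that by (simp add: zero_le_mult_iff)
  qed
  then have "\<forall>\<^sub>F r in at_right 0. 0 \<le> L\<^sub>0 + pi * r"
    using R by (auto simp: eventually_at_right_field)
  moreover have "((\<lambda>r. L\<^sub>0 + pi * r) \<longlongrightarrow> L\<^sub>0 + pi * 0) (at_right 0)"
    by (intro tendsto_intros)
  ultimately have L0: "0 \<le> L\<^sub>0"
    by (metis add.right_neutral mult_zero_right tendsto_lowerbound trivial_limit_at_right_real)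
  have "distributed M lborel (\<lambda>\<omega>. infdist (X \<omega>) S) (\<lambda>r. ennreal (if 0 \<le> r \<and> r < R then f r / F R else 0))"
    by (rule distributed_infdist[OF S _ assms(5,6) V_le])
      (use R L0 in \<open>auto simp: F_def f_def intro!: derivative_eq_intros\<close>)
  moreover have "0 \<le> f r / F R" if "0 \<le> r" for r
    using that R L0 by (simp add: f_def F_def)
  ultimately have D: "has_density M (\<lambda>\<omega>. infdist (X \<omega>) S)
      (\<lambda>r. if 0 \<le> r \<and> r < R then (L\<^sub>0 + 2 * pi * r) / (L\<^sub>0 * R + pi * R\<^sup>2) else 0)"
    by (simp add: has_density_def f_def F_def cong: if_cong)
  have mixture: "AE r in lborel. 0 \<le> r \<and> r < R \<longrightarrow>
      (L\<^sub>0 + 2 * pi * r) / (L\<^sub>0 * R + pi * R\<^sup>2)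
        = L\<^sub>0 * inverse (L\<^sub>0 + pi * R) * f\<^sub>1 r + (1 - L\<^sub>0 * inverse (L\<^sub>0 + pi * R)) * f\<^sub>2 r"
    if "prob_space M\<^sub>1" "uniformly_distributed_on M\<^sub>1 Z\<^sub>1 {0<..<R}" "has_density M\<^sub>1 Z\<^sub>1 f\<^sub>1"
      "prob_space M\<^sub>2" "has_density M\<^sub>2 Z\<^sub>2 (beta_density 2 1)" "has_density M\<^sub>2 (\<lambda>\<omega>. R * Z\<^sub>2 \<omega>) f\<^sub>2"
    for M\<^sub>1 :: "'b measure" and Z\<^sub>1 f\<^sub>1 and M\<^sub>2 :: "'c measure" and Z\<^sub>2 f\<^sub>2
    \<comment> \<open>Both components are known on the open interval; discarding the null set
      \<open>{0}\<close> covers the half-open one.\<close>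
    using uniform_density_unique[OF that(1-3) R] scaled_beta_density_unique[OF that(4-6) R]
      AE_lborel_singleton[of 0]
  proof eventually_elim
    case (elim r)
    \<comment> \<open>With this factor the normalising constant is \<open>R * A\<close> and the
      weights are \<open>L\<^sub>0 / A\<close> and \<open>pi * R / A\<close>.\<close>
    define A where "A = L\<^sub>0 + pi * R"
    have "0 < A"
      using R L0 by (simp add: A_def add_nonneg_pos)
    then have "1 - L\<^sub>0 * inverse A = pi * R / A"
      by (simp add: A_def field_simps)
    moreover have "L\<^sub>0 * inverse A * (1 / R) + pi * R / A * (2 * r / R\<^sup>2) = (L\<^sub>0 + 2 * pi * r) / (R * A)"
      using R \<open>0 < A\<close> by (simp add: field_simps power2_eq_square)
    moreover have "L\<^sub>0 * R + pi * R\<^sup>2 = R * A"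
      by (simp add: A_def power2_eq_square algebra_simps)
    ultimately show ?case
      using elim by (simp add: A_def)
  qed
  show ?thesis
    unfolding Let_def using D mixture by blast
qed

end
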